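(* Let $\mathcal{B}=(\mathbf{e}_n)_{n=1}^\infty$ be a semi-normalized Schauder basis of an infinite-dimensional separable (real or complex) Banach space $\mathbb{X}$. (i) If $\mathcal{B}$ is $C$-almost greedy, then $\mathcal{B}$ is $C$-suppression quasi-greedy and $C$-symmetric for largest coefficients. (ii) Conversely, if $\mathcal{B}$ is $K$-suppression quasi-greedy and $C$-symmetric for largest coefficients, then $\mathcal{B}$ is $CK$-almost greedy.
   Context: Setting: $(\mathbb{X},\Vert\cdot\Vert)$ is an infinite-dimensional separable real or complex Banach space with a Schauder basis $\mathcal{B}=(\mathbf{e}_n)_{n=1}^\infty$ and biorthogonal functionals $(\mathbf{e}_n^* )_{n=1}^\infty$, so that $x=\sum_{n=1}^\infty \mathbf{e}_n^*(x)\mathbf{e}_n$ uniquely for each $x\in\mathbb{X}$. Semi-normalized means $0<\inf_n\Vert \mathbf{e}_n\Vert\le\sup_n\Vert \mathbf{e}_n\Vert<\infty$. $\mathbb{N}=\{1,2,\dots\}$. $\operatorname{supp}(x)=\{n\in\mathbb{N}\colon \mathbf{e}_n^*(x)\neq 0\}$. For finite $A\subset\mathbb{N}$, $P_A(x)=\sum_{n\in A}\mathbf{e}_n^*(x)\mathbf{e}_n$. All constants $C,K$ are $\ge 1$. Greedy orderings: a greedy ordering for $x$ is an injective map $\rho\colon\mathbb{N}\to\mathbb{N}$ with $\operatorname{supp}(x)\subset\rho(\mathbb{N})$ and $|\mathbf{e}_{\rho(i)}^*(x)|\ge|\mathbf{e}_{\rho(j)}^*(x)|$ whenever $i\le j$.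 The natural greedy ordering for $x$ is the unique greedy ordering $\rho$ such that, for $i\le j$, $\rho(i)\le\rho(j)$ if $|\mathbf{e}_{\rho(i)}^*(x)|=|\mathbf{e}_{\rho(j)}^*(x)|$, and such that $\rho(\mathbb{N})=\mathbb{N}$ if $x$ is finitely supported (if $x$ is infinitely supported then $\rho(\mathbb{N})=\operatorname{supp}(x)$). The $m$-th natural greedy approximation is $\mathcal{G}_m(x)=\sum_{i=1}^m\mathbf{e}_{\rho(i)}^*(x)\mathbf{e}_{\rho(i)}$ with $\rho$ the natural greedy ordering for $x$. $C$-almost greedy: for all $x\in\mathbb{X}$ and $m\in\mathbb{N}$, $\Vert x-\mathcal{G}_m(x)\Vert\le C\inf\{\Vert x-P_A(x)\Vert\colon A\subset\mathbb{N},\ |A|=m\}$. Quasi-greedy: $\lim_{m\to\infty}\mathcal{G}_m(x)=x$ for all $x\in\mathbb{X}$; by a theorem of Wojtaszczyk this is equivalent to the existence of a constant $C$ with $\Vert\mathcal{G}_m(x)\Vert\le C\Vert x\Vert$ for all $x\in\mathbb{X}$, $m\in\mathbb{N}$. $C$-suppression quasi-greedy: the basis is quasi-greedy and $\Vert x-\mathcal{G}_m(x)\Vert\le C\Vert x\Vert$ for all $x\in\mathbb{X}$ and $m\in\mathbb{N}$. Disjoint greedy permutation: $y$ is a disjoint greedy permutation of $x$ if $x=z+t\sum_{n\in A}\varepsilon_n\mathbf{e}_n$ and $y=z+t\sum_{n\in B}\theta_n\mathbf{e}_n$ for some $z\in\mathbb{X}$, some disjoint finite sets $A,B\subset\mathbb{N}$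 with $|A|=|B|$ and $\operatorname{supp}(z)\cap(A\cup B)=\emptyset$, some signs (scalars of modulus one) $(\varepsilon_n)_{n\in A}$, $(\theta_n)_{n\in B}$, and some scalar $t$ with $\sup_n|\mathbf{e}_n^*(z)|\le t$. $C$-symmetric for largest coefficients: $\Vert y\Vert\le C\Vert x\Vert$ whenever $x,y$ are finitely supported and $y$ is a disjoint greedy permutation of $x$. *)

theory Defs
  imports "HOL-Analysis.Analysis"
begin

text \<open>
  Real and complex spaces are treated uniformly: the scalar field \<open>'k\<close> is of class
  \<open>real_normed_field\<close>, of which \<open>real\<close> and \<open>complex\<close> are instances (by the Gelfand--Mazur
  theorem they are the only ones, up to isometric isomorphism). Since the class \<open>banach\<close> only
  provides multiplication by real scalars, the multiplication by elements of \<open>'k\<close> is an explicit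
  parameter \<open>sc\<close>. For \<open>'k = real\<close> it is forced to be \<open>(*\<^sub>R)\<close>.
\<close>

locale banach_space_over = vector_space sc
  for sc :: "'k::real_normed_field \<Rightarrow> 'a::banach \<Rightarrow> 'a" +
  assumes norm_sc: "norm (sc c x) = norm c * norm x"
    and sc_of_real: "sc (of_real r) x = r *\<^sub>R x"

definition infinite_dimensional :: "('k::field \<Rightarrow> 'a::ab_group_add \<Rightarrow> 'a) \<Rightarrow> bool"
  where "infinite_dimensional sc \<longleftrightarrow> \<not> (\<exists>B. finite_dimensional_vector_space sc B)"

definition separable_type :: "'a::topological_space itself \<Rightarrow> bool"
  where "separable_type _ \<longleftrightarrow> (\<exists>D::'a set. countable D \<and> closure D = UNIV)"

text \<open>
  Bases are indexed from \<open>0\<close>: the basis vector numbered \<open>n \<ge> 1\<close> in the usual notation is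
  \<open>e (n - 1)\<close>. Likewise a greedy ordering is a map \<open>\<rho>\<close> on \<open>{0, 1, 2, \<dots>}\<close>.
\<close>

definition schauder_basis ::
    "('k::real_normed_field \<Rightarrow> 'a::real_normed_vector \<Rightarrow> 'a) \<Rightarrow> (nat \<Rightarrow> 'a) \<Rightarrow> bool"
  where "schauder_basis sc e \<longleftrightarrow> (\<forall>x. \<exists>!a. (\<lambda>n. sc (a n) (e n)) sums x)"

text \<open>
  \<open>coef sc e x n\<close> is the value at \<open>x\<close> of the \<open>n\<close>-th biorthogonal functional.
\<close>

definition coef ::
    "('k::real_normed_field \<Rightarrow> 'a::real_normed_vector \<Rightarrow> 'a) \<Rightarrow> (nat \<Rightarrow> 'a) \<Rightarrow> 'a \<Rightarrow> nat \<Rightarrow> 'k"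
  where "coef sc e x = (THE a. (\<lambda>n. sc (a n) (e n)) sums x)"

definition semi_normalized :: "(nat \<Rightarrow> 'a::real_normed_vector) \<Rightarrow> bool"
  where "semi_normalized e \<longleftrightarrow> 0 < (INF n. norm (e n)) \<and> bdd_above (range (\<lambda>n. norm (e n)))"

definition supp ::
    "('k::real_normed_field \<Rightarrow> 'a::real_normed_vector \<Rightarrow> 'a) \<Rightarrow> (nat \<Rightarrow> 'a) \<Rightarrow> 'a \<Rightarrow> nat set"
  where "supp sc e x = {n. coef sc e x n \<noteq> 0}"

definition proj ::
    "('k::real_normed_field \<Rightarrow> 'a::real_normed_vector \<Rightarrow> 'a) \<Rightarrow> (nat \<Rightarrow> 'a) \<Rightarrow> nat set \<Rightarrow> 'a \<Rightarrow> 'a"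
  where "proj sc e A x = (\<Sum>n\<in>A. sc (coef sc e x n) (e n))"

definition greedy_ordering ::
    "('k::real_normed_field \<Rightarrow> 'a::real_normed_vector \<Rightarrow> 'a) \<Rightarrow> (nat \<Rightarrow> 'a) \<Rightarrow> 'a \<Rightarrow> (nat \<Rightarrow> nat) \<Rightarrow> bool"
  where "greedy_ordering sc e x \<rho> \<longleftrightarrow>
    inj \<rho> \<and> supp sc e x \<subseteq> range \<rho> \<and>
    (\<forall>i j. i \<le> j \<longrightarrow> norm (coef sc e x (\<rho> i)) \<ge> norm (coef sc e x (\<rho> j)))"

text \<open>
  If the support is infinite, then \<open>range \<rho> = supp sc e x\<close> holds for every greedy ordering
  \<open>\<rho>\<close>, so this needs no separate clause.
\<close>

definition natural_greedy_ordering ::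
    "('k::real_normed_field \<Rightarrow> 'a::real_normed_vector \<Rightarrow> 'a) \<Rightarrow> (nat \<Rightarrow> 'a) \<Rightarrow> 'a \<Rightarrow> (nat \<Rightarrow> nat) \<Rightarrow> bool"
  where "natural_greedy_ordering sc e x \<rho> \<longleftrightarrow>
    greedy_ordering sc e x \<rho> \<and>
    (\<forall>i j. i \<le> j \<and> norm (coef sc e x (\<rho> i)) = norm (coef sc e x (\<rho> j)) \<longrightarrow> \<rho> i \<le> \<rho> j) \<and>
    (finite (supp sc e x) \<longrightarrow> range \<rho> = UNIV)"

text \<open>
  For a semi-normalized Schauder basis the coefficients of \<open>x\<close> tend to \<open>0\<close>, so the natural greedy
  ordering exists and is unique, and the description below denotes it.
\<close>

definition greedy_approx ::
    "('k::real_normed_field \<Rightarrow> 'a::real_normed_vector \<Rightarrow> 'a) \<Rightarrow> (nat \<Rightarrow> 'a) \<Rightarrow> nat \<Rightarrow> 'a \<Rightarrow> 'a"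
  where "greedy_approx sc e m x =
    (let \<rho> = (THE \<rho>. natural_greedy_ordering sc e x \<rho>)
     in \<Sum>i<m. sc (coef sc e x (\<rho> i)) (e (\<rho> i)))"

definition almost_greedy ::
    "('k::real_normed_field \<Rightarrow> 'a::real_normed_vector \<Rightarrow> 'a) \<Rightarrow> (nat \<Rightarrow> 'a) \<Rightarrow> real \<Rightarrow> bool"
  where "almost_greedy sc e C \<longleftrightarrow>
    (\<forall>x. \<forall>m\<ge>1. norm (x - greedy_approx sc e m x)
      \<le> C * (INF A\<in>{A. finite A \<and> card A = m}. norm (x - proj sc e A x)))"

definition quasi_greedy ::
    "('k::real_normed_field \<Rightarrow> 'a::real_normed_vector \<Rightarrow> 'a) \<Rightarrow> (nat \<Rightarrow> 'a) \<Rightarrow> bool"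
  where "quasi_greedy sc e \<longleftrightarrow> (\<forall>x. (\<lambda>m. greedy_approx sc e m x) \<longlonglongrightarrow> x)"

definition suppression_quasi_greedy ::
    "('k::real_normed_field \<Rightarrow> 'a::real_normed_vector \<Rightarrow> 'a) \<Rightarrow> (nat \<Rightarrow> 'a) \<Rightarrow> real \<Rightarrow> bool"
  where "suppression_quasi_greedy sc e C \<longleftrightarrow>
    quasi_greedy sc e \<and> (\<forall>x. \<forall>m\<ge>1. norm (x - greedy_approx sc e m x) \<le> C * norm x)"

text \<open>
  The scalar \<open>t\<close> is compared with a supremum of absolute values, hence it is a nonnegative real
  number. The condition \<open>\<forall>n. norm (coef sc e z n) \<le> t\<close> says that this supremum is at most \<open>t\<close>.
\<close>

definition disjoint_greedy_permutation ::
    "('k::real_normed_field \<Rightarrow> 'a::real_normed_vector \<Rightarrow> 'a) \<Rightarrow> (nat \<Rightarrow> 'a) \<Rightarrow> 'a \<Rightarrow> 'a \<Rightarrow> bool"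
  where "disjoint_greedy_permutation sc e x y \<longleftrightarrow>
    (\<exists>z A B \<epsilon> \<theta> (t::real).
      finite A \<and> finite B \<and> A \<inter> B = {} \<and> card A = card B \<and>
      supp sc e z \<inter> (A \<union> B) = {} \<and>
      (\<forall>n\<in>A. norm (\<epsilon> n) = 1) \<and> (\<forall>n\<in>B. norm (\<theta> n) = 1) \<and>
      (\<forall>n. norm (coef sc e z n) \<le> t) \<and>
      x = z + t *\<^sub>R (\<Sum>n\<in>A. sc (\<epsilon> n) (e n)) \<and>
      y = z + t *\<^sub>R (\<Sum>n\<in>B. sc (\<theta> n) (e n)))"

definition symmetric_largest_coeffs ::
    "('k::real_normed_field \<Rightarrow> 'a::real_normed_vector \<Rightarrow> 'a) \<Rightarrow> (nat \<Rightarrow> 'a) \<Rightarrow> real \<Rightarrow> bool"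
  where "symmetric_largest_coeffs sc e C \<longleftrightarrow>
    (\<forall>x y. finite (supp sc e x) \<and> finite (supp sc e y) \<and> disjoint_greedy_permutation sc e x y
      \<longrightarrow> norm y \<le> C * norm x)"

end

theory Submission
  imports Defs
begin

text \<open>
  A greedy sum keeps the coefficients on a set \<open>A\<close> of \<open>m\<close> indices on which the absolute values
  are at least as large as off \<open>A\<close>. Once the natural greedy ordering is known to exist and to
  be unique, only this matters (\<open>greedy_approx_eq_proj\<close>), together with the remark that a set whose
  absolute values strictly dominate the others must be the set that is chosen
  (\<open>greedy_approx_card_eq_proj\<close>).

  An almost greedy basis lets the greedy remainder compete with any projection on \<open>m\<close> indices.
  Competing with the first \<open>m\<close> indices gives convergence of the greedy sums, and competing with
  blocks of \<open>m\<close> indices that move to infinity gives the suppression bound. For symmetry, put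
  both blocks of a disjoint greedy permutation into one vector and raise the first one from
  height \<open>t\<close> to \<open>t + \<delta>\<close>. Greedy suppression then removes the first block and leaves
  \<open>y\<close>, while the competitor removes the second block and leaves a vector that tends to \<open>x\<close>
  as \<open>\<delta>\<close> tends to \<open>0\<close>.

  Conversely, let \<open>A\<close> be the greedy set of \<open>x\<close>, let \<open>t\<close> be the smallest absolute value on
  \<open>A\<close>, let \<open>B\<close> be a competitor, and let \<open>z\<close> be the part of \<open>x\<close> off \<open>A \<union> B\<close>. The remainder
  \<open>x - P\<^sub>A x\<close> is \<open>z\<close> plus terms on \<open>B - A\<close> with coefficients of size at most \<open>t\<close>. By convexity
  its norm is at most that of some \<open>z + t \<Sum> \<theta>\<^sub>n e\<^sub>n\<close> with signs \<open>\<theta>\<^sub>n\<close> on \<open>B - A\<close>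
  (\<open>norm_add_sum_le_unimodular\<close>). Symmetry moves this block to \<open>A - B\<close> at the cost of \<open>C\<close>, with
  signs of our choice. With the signs of the coefficients of \<open>x\<close> the result is the
  truncation of \<open>x - P\<^sub>B x\<close> at height \<open>t\<close>. Truncation costs only \<open>K\<close>, since it is an average of
  greedy suppressions (\<open>norm_truncation_le\<close>).
\<close>


section \<open>Enumerating a set of order type omega\<close>

text \<open>
  The enumeration is the inverse of the rank function, which counts the elements of \<open>S\<close> below
  a given one. Uniqueness holds because an increasing enumeration takes a value of rank \<open>i\<close>
  at \<open>i\<close>.
\<close>

lemma ex1_increasing_enumeration:
  fixes less :: "'b \<Rightarrow> 'b \<Rightarrow> bool"
  assumes infinite: "infinite S"
    and irrefl: "\<And>a. \<not> less a a"
    and trans: "\<And>a b c. less a b \<Longrightarrow> less b c \<Longrightarrow> less a c"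
    and total: "\<And>a b. a \<noteq> b \<Longrightarrow> less a b \<or> less b a"
    and finite_below: "\<And>b. b \<in> S \<Longrightarrow> finite {a \<in> S. less a b}"
  shows "\<exists>!\<rho>::nat \<Rightarrow> 'b. bij_betw \<rho> UNIV S \<and> (\<forall>i j. i < j \<longrightarrow> less (\<rho> i) (\<rho> j))"
proof -
  define below where "below b = {a \<in> S. less a b}" for b
  define rank where "rank b = card (below b)" for b
  have rank_less: "rank a < rank b" if "a \<in> S" "b \<in> S" "less a b" for a b
    unfolding rank_def
  proof (rule psubset_card_mono)
    show "finite (below b)" using finite_below that by (simp add: below_def)
    have "below a \<subseteq> below b" using that trans by (auto simp: below_def)
    moreover have "a \<in> below b" "a \<notin> below a" using that irrefl by (auto simp: below_def)
    ultimately show "below a \<subset> below b" by blast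
  qed
  have inj: "inj_on rank S"
    by (rule inj_onI) (metis rank_less total less_irrefl)
  \<comment> \<open>A strictly increasing map from a set of \<open>r\<close> elements to \<open>{..<r}\<close> is onto, so the
    ranks taken below \<open>b\<close> are all the numbers less than the rank of \<open>b\<close>.\<close>
  have rank_below: "rank ` below b = {..<rank b}" if "b \<in> S" for b
  proof (rule card_subset_eq)
    show "rank ` below b \<subseteq> {..<rank b}" using rank_less that by (auto simp: below_def)
    have "inj_on rank (below b)" by (rule inj_on_subset[OF inj]) (auto simp: below_def)
    then have "card (rank ` below b) = card (below b)" by (rule card_image)
    then show "card (rank ` below b) = card {..<rank b}" by (simp add: rank_def[of b])
  qed simp
  have surj: "rank ` S = UNIV"
  proof -
    have "i \<in> rank ` S" for i
    proof -
      have "infinite (rank ` S)" using inj infinite by (simp add: finite_image_iff)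
      then obtain b where "b \<in> S" "i < rank b"
        by (metis infinite_nat_iff_unbounded imageE)
      then have "i \<in> rank ` below b" using rank_below by simp
      then show ?thesis by (auto simp: below_def)
    qed
    then show ?thesis by auto
  qed
  have bij: "bij_betw rank S UNIV" using inj surj by (simp add: bij_betw_def)
  show ?thesis
  proof (rule ex1I)
    let ?\<rho> = "inv_into S rank"
    have mem: "?\<rho> i \<in> S" and r: "rank (?\<rho> i) = i" for i
      using surj by (simp_all add: inv_into_into f_inv_into_f)
    have "less (?\<rho> i) (?\<rho> j)" if "i < j" for i j
    proof -
      have "?\<rho> i \<noteq> ?\<rho> j" using r that by (metis less_irrefl)
      moreover have "\<not> less (?\<rho> j) (?\<rho> i)"
        using rank_less[OF mem mem, of j i] r that by auto
      ultimately show ?thesis using total by blast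
    qed
    then show "bij_betw ?\<rho> UNIV S \<and> (\<forall>i j. i < j \<longrightarrow> less (?\<rho> i) (?\<rho> j))"
      using bij_betw_inv_into[OF bij] by blast
  next
    fix \<sigma> :: "nat \<Rightarrow> 'b"
    assume \<sigma>: "bij_betw \<sigma> UNIV S \<and> (\<forall>i j. i < j \<longrightarrow> less (\<sigma> i) (\<sigma> j))"
    have range: "range \<sigma> = S" and inj\<sigma>: "inj \<sigma>" using \<sigma> by (auto simp: bij_betw_def)
    show "\<sigma> = inv_into S rank"
    proof
      fix i
      have "less (\<sigma> j) (\<sigma> i) \<longleftrightarrow> j < i" for j
        using \<sigma> irrefl trans by (metis linorder_neqE_nat)
      then have "below (\<sigma> i) = \<sigma> ` {..<i}" using range by (auto simp: below_def)
      then have "rank (\<sigma> i) = i"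
        using inj\<sigma> by (simp add: rank_def card_image inj_on_def)
      then show "\<sigma> i = inv_into S rank i"
        using inj range by (metis inv_into_f_f rangeI)
    qed
  qed
qed


section \<open>Two convexity estimates for norms\<close>

lemma norm_segment_le:
  fixes p q :: "'a::real_normed_vector"
  assumes "\<bar>r\<bar> \<le> t" "norm (p + t *\<^sub>R q) \<le> M" "norm (p - t *\<^sub>R q) \<le> M"
  shows "norm (p + r *\<^sub>R q) \<le> M"
proof (cases "t = 0")
  case True
  then show ?thesis using assms by simp
next
  case False
  with assms have t: "t > 0" by linarith
  have 1: "2 * t = (t + r) + (t - r)" and 2: "2 * t * r = (t + r) * t - (t - r) * t"
    by algebra+
  have "(2 * t) *\<^sub>R (p + r *\<^sub>R q) = (t + r) *\<^sub>R (p + t *\<^sub>R q) + (t - r) *\<^sub>R (p - t *\<^sub>R q)"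
    unfolding scaleR_add_right scaleR_diff_right scaleR_scaleR 2
    unfolding 1 scaleR_add_left scaleR_diff_left by simp
  then have "2 * t * norm (p + r *\<^sub>R q)
      = norm ((t + r) *\<^sub>R (p + t *\<^sub>R q) + (t - r) *\<^sub>R (p - t *\<^sub>R q))"
    using t by (metis abs_of_pos mult_pos_pos norm_scaleR zero_less_numeral)
  also have "\<dots> \<le> (t + r) * norm (p + t *\<^sub>R q) + (t - r) * norm (p - t *\<^sub>R q)"
    using assms(1) by (intro order_trans[OF norm_triangle_ineq]) auto
  also have "\<dots> \<le> (t + r) * M + (t - r) * M"
    using assms by (intro add_mono mult_left_mono) auto
  finally have "(2 * t) * norm (p + r *\<^sub>R q) \<le> (2 * t) * M" by (simp add: algebra_simps)
  then show ?thesis using t by simp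
qed

text \<open>
  Since \<open>f n\<close> is the length of \<open>{s \<in> {0..1}. s \<le> f n}\<close>, the weighted sum is the average over
  \<open>s \<in> {0..1}\<close> of the unweighted sums over the level sets \<open>{n. s \<le> f n}\<close>.
\<close>

lemma norm_weighted_sum_le_level_sets:
  fixes z :: "'a::banach" and f :: "'i \<Rightarrow> real"
  assumes D: "finite D" and f: "\<And>n. n \<in> D \<Longrightarrow> 0 \<le> f n \<and> f n \<le> 1"
    and level: "\<And>s. 0 \<le> s \<Longrightarrow> s \<le> 1 \<Longrightarrow> norm (z + (\<Sum>n | n \<in> D \<and> s \<le> f n. v n)) \<le> M"
  shows "norm (z + (\<Sum>n\<in>D. f n *\<^sub>R v n)) \<le> M"
proof -
  have "((\<lambda>s. if s \<in> {0..f n} then v n else 0) has_integral f n *\<^sub>R v n) {0..1}"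
    if "n \<in> D" for n
  proof -
    have "((\<lambda>s. v n) has_integral f n *\<^sub>R v n) {0..f n}"
      using has_integral_const_real[of "v n" 0 "f n"] f[OF that] by simp
    then show ?thesis using f[OF that]
      by (intro has_integral_restrict[THEN iffD2]) auto
  qed
  then have "((\<lambda>s. \<Sum>n\<in>D. if s \<in> {0..f n} then v n else 0)
      has_integral (\<Sum>n\<in>D. f n *\<^sub>R v n)) {0..1}"
    using D by (intro has_integral_sum) auto
  moreover have "((\<lambda>s. z) has_integral z) {0..1::real}"
    using has_integral_const_real[of z 0 1] by simp
  ultimately have integral: "((\<lambda>s. z + (\<Sum>n\<in>D. if s \<in> {0..f n} then v n else 0))
      has_integral z + (\<Sum>n\<in>D. f n *\<^sub>R v n)) {0..1}"
    by (intro has_integral_add)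
  have bound: "norm (z + (\<Sum>n\<in>D. if s \<in> {0..f n} then v n else 0)) \<le> M"
    if "s \<in> {0..1}" for s
  proof -
    have "(\<Sum>n\<in>D. if s \<in> {0..f n} then v n else 0) = (\<Sum>n | n \<in> D \<and> s \<le> f n. v n)"
      using D that by (simp add: sum.inter_filter)
    then show ?thesis using level that by simp
  qed
  have "0 \<le> M" using order_trans[OF norm_ge_zero level[of 0]] by simp
  then show ?thesis
    using has_integral_bound_real[OF _ _ integral, of M "{}"] bound by simp
qed


section \<open>Coefficients with respect to a Schauder basis\<close>

locale semi_normalized_basis = banach_space_over sc
  for sc :: "'k::real_normed_field \<Rightarrow> 'a::banach \<Rightarrow> 'a" +
  fixes e :: "nat \<Rightarrow> 'a"
  assumes basis: "schauder_basis sc e"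
    and semi_norm: "semi_normalized e"
begin

abbreviation coefficient :: "'a \<Rightarrow> nat \<Rightarrow> 'k" where "coefficient \<equiv> coef sc e"

lemma ex1_coefficients: "\<exists>!a. (\<lambda>n. sc (a n) (e n)) sums x"
  using basis unfolding schauder_basis_def by blast

lemma coef_eqI: "(\<lambda>n. sc (a n) (e n)) sums x \<Longrightarrow> coefficient x = a"
  unfolding coef_def by (rule the1_equality[OF ex1_coefficients])

lemma coef_sums: "(\<lambda>n. sc (coefficient x n) (e n)) sums x"
  unfolding coef_def by (rule theI'[OF ex1_coefficients])

lemma coef_add: "coefficient (x + y) n = coefficient x n + coefficient y n"
proof -
  have "coefficient (x + y) = (\<lambda>n. coefficient x n + coefficient y n)"
    using sums_add[OF coef_sums[of x] coef_sums[of y]]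
    by (intro coef_eqI) (simp add: scale_left_distrib)
  then show ?thesis by simp
qed

lemma coef_diff: "coefficient (x - y) n = coefficient x n - coefficient y n"
  using coef_add[of "x - y" y n] by (simp add: algebra_simps)

lemma coef_sum:
  assumes "finite F"
  shows "coefficient (\<Sum>n\<in>F. sc (a n) (e n)) k = (if k \<in> F then a k else 0)"
proof -
  have "(\<lambda>n. if n \<in> F then sc (a n) (e n) else 0) sums (\<Sum>n\<in>F. sc (a n) (e n))"
    by (rule sums_If_finite_set[OF assms])
  moreover have "(\<lambda>n. if n \<in> F then sc (a n) (e n) else 0)
      = (\<lambda>n. sc (if n \<in> F then a n else 0) (e n))"
    by auto
  ultimately have "coefficient (\<Sum>n\<in>F. sc (a n) (e n)) = (\<lambda>n. if n \<in> F then a n else 0)"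
    by (intro coef_eqI) simp
  then show ?thesis by simp
qed

lemma coef_proj: "finite F \<Longrightarrow> coefficient (proj sc e F x) k = (if k \<in> F then coefficient x k else 0)"
  unfolding proj_def by (rule coef_sum)

lemma scaleR_sum_basis: "t *\<^sub>R (\<Sum>n\<in>F. sc (a n) (e n)) = (\<Sum>n\<in>F. sc (of_real t * a n) (e n))"
  by (simp add: scale_sum_right flip: sc_of_real)

lemma proj_initial_tendsto: "(\<lambda>N. proj sc e {..<N} x) \<longlonglongrightarrow> x"
  using coef_sums[of x] by (simp add: sums_def proj_def)

lemma proj_block_tendsto_0: "(\<lambda>N. proj sc e {N..<N + m} x) \<longlonglongrightarrow> 0"
proof -
  have "proj sc e {N..<N + m} x = proj sc e {..<N + m} x - proj sc e {..<N} x" for N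
    unfolding proj_def by (subst sum_diff[symmetric]) (auto simp: lessThan_minus_lessThan)
  moreover have "(\<lambda>N. proj sc e {..<N + m} x - proj sc e {..<N} x) \<longlonglongrightarrow> x - x"
    by (intro tendsto_diff LIMSEQ_ignore_initial_segment proj_initial_tendsto)
  ultimately show ?thesis by simp
qed

text \<open>
  The terms of the convergent expansion tend to \<open>0\<close>, and the norms of the basis vectors are
  bounded away from \<open>0\<close>, so the coefficients tend to \<open>0\<close>.
\<close>

lemma finite_coef_ge:
  assumes "0 < r"
  shows "finite {n. r \<le> norm (coefficient x n)}"
proof -
  define c where "c = (INF n. norm (e n))"
  have c: "0 < c" using semi_norm by (simp add: semi_normalized_def c_def)
  have c_le: "c \<le> norm (e n)" for n
    unfolding c_def by (rule cINF_lower) (auto intro: bdd_belowI[of _ 0])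
  have "(\<lambda>n. norm (sc (coefficient x n) (e n))) \<longlonglongrightarrow> 0"
    using coef_sums[of x] by (intro tendsto_norm_zero summable_LIMSEQ_zero) (rule sums_summable)
  then have "\<forall>\<^sub>F n in sequentially. norm (sc (coefficient x n) (e n)) < r * c"
    using c assms by (intro order_tendstoD) auto
  then have "finite {n. \<not> norm (sc (coefficient x n) (e n)) < r * c}"
    by (simp add: cofinite_eq_sequentially[symmetric] eventually_cofinite)
  moreover have "r * c \<le> norm (sc (coefficient x n) (e n))" if "r \<le> norm (coefficient x n)" for n
    using that c c_le[of n] assms by (auto simp: norm_sc intro: mult_mono)
  then have "{n. r \<le> norm (coefficient x n)}
      \<subseteq> {n. \<not> norm (sc (coefficient x n) (e n)) < r * c}"
    by (auto simp: not_less)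
  ultimately show ?thesis using finite_subset by blast
qed


section \<open>The natural greedy ordering\<close>

definition precedes :: "'a \<Rightarrow> nat \<Rightarrow> nat \<Rightarrow> bool"
  where "precedes x n k \<longleftrightarrow> norm (coefficient x k) < norm (coefficient x n)
    \<or> norm (coefficient x k) = norm (coefficient x n) \<and> n < k"

text \<open>
  For a vector of finite support the definition of a natural greedy ordering prescribes the range;
  for infinite support \<open>range_greedy_ordering\<close> shows that there is no other choice.
\<close>

definition greedy_range :: "'a \<Rightarrow> nat set"
  where "greedy_range x = (if finite (supp sc e x) then UNIV else supp sc e x)"

text \<open>
  Once a greedy ordering meets a zero coefficient, it meets only zeros from there on, so the
  whole support has been enumerated by then and is finite.
\<close>

lemma range_greedy_ordering:
  assumes "greedy_ordering sc e x \<rho>" "infinite (supp sc e x)"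
  shows "range \<rho> = supp sc e x"
proof -
  have "\<rho> i \<in> supp sc e x" for i
  proof (rule ccontr)
    assume "\<rho> i \<notin> supp sc e x"
    then have "\<rho> j \<notin> supp sc e x" if "i \<le> j" for j
      using assms(1) that unfolding greedy_ordering_def supp_def
      by (metis (mono_tags, lifting) mem_Collect_eq norm_eq_zero norm_le_zero_iff)
    then have "supp sc e x \<subseteq> \<rho> ` {..<i}"
      using assms(1) unfolding greedy_ordering_def by (force simp: not_le[symmetric])
    then show False using assms(2) finite_subset by blast
  qed
  then show ?thesis using assms(1) unfolding greedy_ordering_def by auto
qed

lemma natural_greedy_ordering_iff:
  "natural_greedy_ordering sc e x \<rho> \<longleftrightarrow>
    bij_betw \<rho> UNIV (greedy_range x) \<and> (\<forall>i j. i < j \<longrightarrow> precedes x (\<rho> i) (\<rho> j))"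
    (is "?L \<longleftrightarrow> ?R")
proof
  assume L: ?L
  then have g: "greedy_ordering sc e x \<rho>" by (simp add: natural_greedy_ordering_def)
  then have "inj \<rho>" by (simp add: greedy_ordering_def)
  moreover have "range \<rho> = greedy_range x"
    using L range_greedy_ordering[OF g]
    by (auto simp: natural_greedy_ordering_def greedy_range_def)
  moreover have "precedes x (\<rho> i) (\<rho> j)" if "i < j" for i j
  proof -
    have "\<rho> i \<noteq> \<rho> j" using \<open>inj \<rho>\<close> that by (simp add: inj_eq)
    moreover have "norm (coefficient x (\<rho> j)) \<le> norm (coefficient x (\<rho> i))"
      using g that by (simp add: greedy_ordering_def)
    moreover have "norm (coefficient x (\<rho> i)) = norm (coefficient x (\<rho> j)) \<Longrightarrow> \<rho> i \<le> \<rho> j"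
      using L that by (simp add: natural_greedy_ordering_def)
    ultimately show ?thesis unfolding precedes_def by linarith
  qed
  ultimately show ?R by (simp add: bij_betw_def)
next
  assume R: ?R
  then have "inj \<rho>" and r: "range \<rho> = greedy_range x" by (auto simp: bij_betw_def)
  moreover have "supp sc e x \<subseteq> greedy_range x" by (simp add: greedy_range_def)
  moreover have "i = j \<or> precedes x (\<rho> i) (\<rho> j)" if "i \<le> j" for i j
    using R that le_less by blast
  ultimately show ?L
    unfolding natural_greedy_ordering_def greedy_ordering_def
    by (fastforce simp: precedes_def greedy_range_def)
qed

text \<open>
  Only finitely many coefficients are as large as a given nonzero one. An index with zero
  coefficient belongs to the range only for finite support, and it is preceded only by
  the support and by smaller indices.
\<close>

lemma ex1_natural_greedy_ordering: "\<exists>!\<rho>. natural_greedy_ordering sc e x \<rho>"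
  unfolding natural_greedy_ordering_iff
proof (rule ex1_increasing_enumeration)
  show "infinite (greedy_range x)" by (simp add: greedy_range_def)
  show "\<not> precedes x n n" for n by (simp add: precedes_def)
  show "precedes x n l" if "precedes x n k" "precedes x k l" for n k l
    using that by (auto simp: precedes_def)
  show "precedes x n k \<or> precedes x k n" if "n \<noteq> k" for n k
    using that by (auto simp: precedes_def)
  show "finite {n \<in> greedy_range x. precedes x n k}" if "k \<in> greedy_range x" for k
  proof (cases "k \<in> supp sc e x")
    case True
    then have "finite {n. norm (coefficient x k) \<le> norm (coefficient x n)}"
      by (intro finite_coef_ge) (simp add: supp_def)
    then show ?thesis by (rule finite_subset[rotated]) (auto simp: precedes_def)
  next
    case False
    then have "finite (supp sc e x)" using that by (auto simp: greedy_range_def split: if_splits)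
    then have "finite (supp sc e x \<union> {..<k})" by simp
    moreover have "{n \<in> greedy_range x. precedes x n k} \<subseteq> supp sc e x \<union> {..<k}"
      using False by (auto simp: precedes_def supp_def)
    ultimately show ?thesis using finite_subset by blast
  qed
qed

lemma greedy_approx_eq_proj:
  obtains A where "finite A" "card A = m" "greedy_approx sc e m x = proj sc e A x"
    "\<And>n k. n \<in> A \<Longrightarrow> k \<notin> A \<Longrightarrow> norm (coefficient x k) \<le> norm (coefficient x n)"
proof -
  define \<rho> where "\<rho> = (THE \<rho>. natural_greedy_ordering sc e x \<rho>)"
  have "natural_greedy_ordering sc e x \<rho>"
    unfolding \<rho>_def by (rule theI'[OF ex1_natural_greedy_ordering])
  then have inj: "inj \<rho>" and supp: "supp sc e x \<subseteq> range \<rho>"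
    and decr: "\<And>i j. i \<le> j \<Longrightarrow> norm (coefficient x (\<rho> j)) \<le> norm (coefficient x (\<rho> i))"
    by (auto simp: natural_greedy_ordering_def greedy_ordering_def)
  have inj': "inj_on \<rho> {..<m}" using inj by (simp add: inj_on_def)
  show thesis
  proof
    show "finite (\<rho> ` {..<m})" by simp
    show "card (\<rho> ` {..<m}) = m" using inj' by (simp add: card_image)
    show "greedy_approx sc e m x = proj sc e (\<rho> ` {..<m}) x"
      using inj' by (simp add: greedy_approx_def proj_def sum.reindex flip: \<rho>_def)
    show "norm (coefficient x k) \<le> norm (coefficient x n)"
      if n: "n \<in> \<rho> ` {..<m}" and k: "k \<notin> \<rho> ` {..<m}" for n k
    proof (cases "k \<in> range \<rho>")
      case True
      then obtain j where "k = \<rho> j" by blast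
      with k have "m \<le> j" by (meson imageI lessThan_iff not_le)
      with n \<open>k = \<rho> j\<close> show ?thesis using decr by auto
    next
      case False
      then have "coefficient x k = 0" using supp by (auto simp: supp_def)
      then show ?thesis by simp
    qed
  qed
qed

text \<open>
  Two different sets of equal size each contain an index that the other lacks. Comparing these two
  indices, strict dominance of \<open>A\<close> contradicts weak dominance of the greedy set.
\<close>

lemma greedy_approx_card_eq_proj:
  assumes "finite A"
    and strict: "\<And>n k. n \<in> A \<Longrightarrow> k \<notin> A \<Longrightarrow> norm (coefficient x k) < norm (coefficient x n)"
  shows "greedy_approx sc e (card A) x = proj sc e A x"
proof -
  obtain G where G: "finite G" "card G = card A" "greedy_approx sc e (card A) x = proj sc e G x"
    "\<And>n k. n \<in> G \<Longrightarrow> k \<notin> G \<Longrightarrow> norm (coefficient x k) \<le> norm (coefficient x n)"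
    using greedy_approx_eq_proj[of "card A" x] by blast
  have "G = A"
  proof (rule ccontr)
    assume "G \<noteq> A"
    then have "\<not> G \<subseteq> A" "\<not> A \<subseteq> G"
      using G(1,2) assms(1) by (metis card_subset_eq)+
    then obtain n k where "n \<in> A" "n \<notin> G" "k \<in> G" "k \<notin> A" by blast
    then show False using strict[of n k] G(4)[of k n] by simp
  qed
  then show ?thesis using G(3) by simp
qed


section \<open>Consequences of almost greediness\<close>

lemma almost_greedy_le:
  assumes "almost_greedy sc e C" "0 \<le> C" "finite A" "card A = m" "1 \<le> m"
  shows "norm (x - greedy_approx sc e m x) \<le> C * norm (x - proj sc e A x)"
proof -
  have "(INF A\<in>{A. finite A \<and> card A = m}. norm (x - proj sc e A x)) \<le> norm (x - proj sc e A x)"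
    using assms by (intro cINF_lower) (auto intro: bdd_belowI[of _ 0])
  with assms show ?thesis
    unfolding almost_greedy_def by (meson mult_left_mono order_trans)
qed

lemma almost_greedy_imp_quasi_greedy:
  assumes "almost_greedy sc e C" "0 \<le> C"
  shows "quasi_greedy sc e"
  unfolding quasi_greedy_def
proof
  fix x
  have "\<forall>\<^sub>F m in sequentially.
      norm (greedy_approx sc e m x - x) \<le> C * norm (proj sc e {..<m} x - x)"
    using eventually_ge_at_top[of 1]
  proof eventually_elim
    case (elim m)
    then show ?case
      using almost_greedy_le[OF assms, of "{..<m}" m x] by (simp add: norm_minus_commute)
  qed
  moreover have "(\<lambda>m. C * norm (proj sc e {..<m} x - x)) \<longlonglongrightarrow> 0"
    using tendsto_mult_right_zero[OF tendsto_norm_zero[OF LIM_zero[OF proj_initial_tendsto]]] .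
  ultimately have "(\<lambda>m. greedy_approx sc e m x - x) \<longlonglongrightarrow> 0"
    by (rule Lim_null_comparison)
  then show "(\<lambda>m. greedy_approx sc e m x) \<longlonglongrightarrow> x" by (rule LIM_zero_cancel)
qed

lemma almost_greedy_imp_suppression_quasi_greedy:
  assumes "almost_greedy sc e C" "0 \<le> C"
  shows "suppression_quasi_greedy sc e C"
  unfolding suppression_quasi_greedy_def
proof (intro conjI allI impI)
  show "quasi_greedy sc e" using almost_greedy_imp_quasi_greedy assms .
  fix x and m :: nat
  assume m: "1 \<le> m"
  have "(\<lambda>N. C * norm (x - proj sc e {N..<N + m} x)) \<longlonglongrightarrow> C * norm (x - 0)"
    by (intro tendsto_intros proj_block_tendsto_0)
  moreover have "norm (x - greedy_approx sc e m x) \<le> C * norm (x - proj sc e {N..<N + m} x)" for N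
    using almost_greedy_le[OF assms] m by simp
  ultimately show "norm (x - greedy_approx sc e m x) \<le> C * norm x"
    using LIMSEQ_le_const by fastforce
qed

text \<open>
  The block on \<open>A\<close> and the block on \<open>B\<close> have the same height in \<open>x\<close> and \<open>y\<close>, so the greedy
  set of their union would depend on how ties are broken. Raising the block on \<open>A\<close> by \<open>\<delta>\<close>
  makes it strictly dominant.
\<close>

lemma almost_greedy_imp_symmetric:
  assumes ag: "almost_greedy sc e C" and C: "1 \<le> C"
    and perm: "disjoint_greedy_permutation sc e x y"
  shows "norm y \<le> C * norm x"
proof -
  obtain z A B \<epsilon> \<theta> and t :: real where fin: "finite A" "finite B"
    and AB: "A \<inter> B = {}" and card: "card A = card B"
    and supp: "supp sc e z \<inter> (A \<union> B) = {}"
    and \<epsilon>: "\<And>n. n \<in> A \<Longrightarrow> norm (\<epsilon> n) = 1" and \<theta>: "\<And>n. n \<in> B \<Longrightarrow> norm (\<theta> n) = 1"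
    and t: "\<And>n. norm (coefficient z n) \<le> t"
    and x: "x = z + t *\<^sub>R (\<Sum>n\<in>A. sc (\<epsilon> n) (e n))"
    and y: "y = z + t *\<^sub>R (\<Sum>n\<in>B. sc (\<theta> n) (e n))"
    using perm unfolding disjoint_greedy_permutation_def by blast
  have t0: "0 \<le> t" using t[of 0] norm_ge_zero order_trans by blast
  define a where "a = (\<Sum>n\<in>A. sc (\<epsilon> n) (e n))"
  define b where "b = (\<Sum>n\<in>B. sc (\<theta> n) (e n))"
  show ?thesis
  proof (cases "card A = 0")
    case True
    then have "A = {}" "B = {}" using fin card by auto
    then have "y = x" using x y by simp
    then show ?thesis using C mult_right_mono[of 1 C "norm x"] by simp
  next
    case False
    have bound: "norm y \<le> C * norm (x + \<delta> *\<^sub>R a)" if \<delta>: "0 < \<delta>" for \<delta>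
    proof -
      define w where "w = z + (t + \<delta>) *\<^sub>R a + t *\<^sub>R b"
      have coef_w: "coefficient w n = coefficient z n
          + (if n \<in> A then of_real (t + \<delta>) * \<epsilon> n else 0) + (if n \<in> B then of_real t * \<theta> n else 0)" for n
        using fin unfolding w_def a_def b_def by (simp add: coef_add scaleR_sum_basis coef_sum)
      have zAB: "coefficient z n = 0" if "n \<in> A \<union> B" for n using supp that by (auto simp: supp_def)
      have wA: "coefficient w n = of_real (t + \<delta>) * \<epsilon> n" if "n \<in> A" for n
        using coef_w zAB that AB by auto
      have wB: "coefficient w n = of_real t * \<theta> n" if "n \<in> B" for n
        using coef_w zAB that AB by auto
      have normA: "norm (coefficient w n) = t + \<delta>" if "n \<in> A" for n
        unfolding wA[OF that] norm_mult norm_of_real using \<epsilon>[OF that] t0 \<delta> by simp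
      have norm_notA: "norm (coefficient w n) \<le> t" if "n \<notin> A" for n
      proof (cases "n \<in> B")
        case True
        show ?thesis unfolding wB[OF True] norm_mult norm_of_real using \<theta>[OF True] t0 by simp
      next
        case False
        then show ?thesis using coef_w[of n] that t[of n] by simp
      qed
      have "norm (coefficient w k) < norm (coefficient w n)" if "n \<in> A" "k \<notin> A" for n k
        using normA[OF that(1)] norm_notA[OF that(2)] \<delta> by linarith
      then have "greedy_approx sc e (card A) w = proj sc e A w"
        using fin(1) by (intro greedy_approx_card_eq_proj)
      also have "\<dots> = (t + \<delta>) *\<^sub>R a"
        unfolding proj_def a_def scaleR_sum_basis using wA by simp
      finally have "w - greedy_approx sc e (card A) w = y"
        by (simp add: w_def y b_def)
      moreover have "proj sc e B w = t *\<^sub>R b"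
        unfolding proj_def b_def scaleR_sum_basis using wB by simp
      then have "w - proj sc e B w = x + \<delta> *\<^sub>R a"
        by (simp add: w_def x a_def scaleR_left_distrib)
      moreover have "0 \<le> C" "1 \<le> card A" using C False by auto
      ultimately show ?thesis
        using almost_greedy_le[OF ag _ fin(2) card[symmetric], of w] by simp
    qed
    have "((\<lambda>\<delta>. C * norm (x + \<delta> *\<^sub>R a)) \<longlongrightarrow> C * norm (x + 0 *\<^sub>R a)) (at_right 0)"
      by (intro tendsto_intros)
    then have "norm y \<le> C * norm (x + 0 *\<^sub>R a)"
      using bound eventually_at_right_less[of "0::real"]
      by (intro tendsto_lowerbound[where F = "at_right 0"]) (auto elim: eventually_mono)
    then show ?thesis by simp
  qed
qed


section \<open>From suppression and symmetry to almost greediness\<close>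

text \<open>
  Symmetry for largest coefficients speaks of finitely supported vectors only. Replacing \<open>z\<close> by
  its partial sums keeps the coefficients bounded by \<open>t\<close> and the blocks disjoint from the
  support, so the estimate passes to the limit.
\<close>

lemma norm_disjoint_greedy_permutation_le:
  assumes sym: "symmetric_largest_coeffs sc e C"
    and perm: "disjoint_greedy_permutation sc e x y"
  shows "norm y \<le> C * norm x"
proof -
  obtain z A B \<epsilon> \<theta> and t :: real where fin: "finite A" "finite B"
    and AB: "A \<inter> B = {}" and card: "card A = card B"
    and supp: "supp sc e z \<inter> (A \<union> B) = {}"
    and \<epsilon>: "\<forall>n\<in>A. norm (\<epsilon> n) = 1" and \<theta>: "\<forall>n\<in>B. norm (\<theta> n) = 1"
    and t: "\<forall>n. norm (coefficient z n) \<le> t"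
    and x: "x = z + t *\<^sub>R (\<Sum>n\<in>A. sc (\<epsilon> n) (e n))"
    and y: "y = z + t *\<^sub>R (\<Sum>n\<in>B. sc (\<theta> n) (e n))"
    using perm unfolding disjoint_greedy_permutation_def by blast
  define a where "a = t *\<^sub>R (\<Sum>n\<in>A. sc (\<epsilon> n) (e n))"
  define b where "b = t *\<^sub>R (\<Sum>n\<in>B. sc (\<theta> n) (e n))"
  have "norm (proj sc e {..<N} z + b) \<le> C * norm (proj sc e {..<N} z + a)" for N
  proof -
    have coef: "coefficient (proj sc e {..<N} z) n = (if n < N then coefficient z n else 0)" for n
      by (simp add: coef_proj)
    have "0 \<le> t" using t norm_ge_zero order_trans by blast
    then have "disjoint_greedy_permutation sc e (proj sc e {..<N} z + a) (proj sc e {..<N} z + b)"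
      unfolding disjoint_greedy_permutation_def
      using fin AB card supp \<epsilon> \<theta> t unfolding a_def b_def supp_def
      by (intro exI[of _ "proj sc e {..<N} z"] exI[of _ A] exI[of _ B] exI[of _ \<epsilon>] exI[of _ \<theta>]
          exI[of _ t]) (auto simp: coef)
    moreover have "supp sc e (proj sc e {..<N} z + a) \<subseteq> {..<N} \<union> A"
      using fin unfolding a_def scaleR_sum_basis
      by (auto simp: supp_def coef_add coef_sum coef split: if_splits)
    then have "finite (supp sc e (proj sc e {..<N} z + a))"
      by (rule finite_subset) (simp add: fin)
    moreover have "supp sc e (proj sc e {..<N} z + b) \<subseteq> {..<N} \<union> B"
      using fin unfolding b_def scaleR_sum_basis
      by (auto simp: supp_def coef_add coef_sum coef split: if_splits)
    then have "finite (supp sc e (proj sc e {..<N} z + b))"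
      by (rule finite_subset) (simp add: fin)
    ultimately show ?thesis using sym unfolding symmetric_largest_coeffs_def by blast
  qed
  moreover have "(\<lambda>N. norm (proj sc e {..<N} z + b)) \<longlonglongrightarrow> norm (z + b)"
    by (intro tendsto_intros proj_initial_tendsto)
  moreover have "(\<lambda>N. C * norm (proj sc e {..<N} z + a)) \<longlonglongrightarrow> C * norm (z + a)"
    by (intro tendsto_intros proj_initial_tendsto)
  ultimately have "norm (z + b) \<le> C * norm (z + a)"
    by (intro LIMSEQ_le) auto
  then show ?thesis by (simp add: x y a_def b_def)
qed

lemma polar_decomposition:
  fixes c :: 'k
  obtains u :: 'k where "norm u = 1" "c = of_real (norm c) * u"
proof (cases "c = 0")
  case True
  then show ?thesis using that[of 1] by simp
next
  case False
  then show ?thesis using that[of "c / of_real (norm c)"] by (simp add: norm_divide)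
qed

text \<open>
  A scalar \<open>r u\<close> with \<open>0 \<le> r \<le> t\<close> and \<open>u\<close> unimodular lies on the segment from \<open>- t u\<close> to
  \<open>t u\<close>. Two signs per coefficient thus suffice for the convexity argument, in the real as in
  the complex case.
\<close>

lemma norm_add_sum_le_unimodular:
  assumes "finite F" "\<And>n. n \<in> F \<Longrightarrow> norm (a n) \<le> t"
    and "\<And>\<theta>. (\<And>n. n \<in> F \<Longrightarrow> norm (\<theta> n) = 1) \<Longrightarrow> norm (z + t *\<^sub>R (\<Sum>n\<in>F. sc (\<theta> n) (e n))) \<le> M"
  shows "norm (z + (\<Sum>n\<in>F. sc (a n) (e n))) \<le> M"
  using assms
proof (induction F arbitrary: z)
  case empty
  then show ?case by simp
next
  case (insert k F)
  obtain u where u: "norm u = 1" "a k = of_real (norm (a k)) * u"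
    using polar_decomposition .
  define q where "q = sc u (e k)"
  have ak: "sc (a k) (e k) = norm (a k) *\<^sub>R q"
    unfolding q_def using u(2) by (metis scale_scale sc_of_real)
  have "norm ((z + norm (a k) *\<^sub>R q) + t *\<^sub>R (\<Sum>n\<in>F. sc (\<theta> n) (e n))) \<le> M"
    if \<theta>: "\<And>n. n \<in> F \<Longrightarrow> norm (\<theta> n) = 1" for \<theta>
  proof -
    define p where "p = z + t *\<^sub>R (\<Sum>n\<in>F. sc (\<theta> n) (e n))"
    have ends: "norm (p + t *\<^sub>R sc v (e k)) \<le> M" if "norm v = 1" for v
    proof -
      have "(\<Sum>n\<in>F. sc ((\<theta>(k := v)) n) (e n)) = (\<Sum>n\<in>F. sc (\<theta> n) (e n))"
        using insert.hyps by (intro sum.cong) auto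
      moreover have "norm ((\<theta>(k := v)) n) = 1" if "n \<in> insert k F" for n
        using \<theta> \<open>norm v = 1\<close> that by auto
      then have "norm (z + t *\<^sub>R (\<Sum>n\<in>insert k F. sc ((\<theta>(k := v)) n) (e n))) \<le> M"
        by (rule insert.prems(2))
      ultimately show ?thesis
        using insert.hyps by (simp add: p_def scaleR_right_distrib add_ac)
    qed
    have "norm (p + norm (a k) *\<^sub>R q) \<le> M"
    proof (rule norm_segment_le)
      show "\<bar>norm (a k)\<bar> \<le> t" using insert.prems(1) by simp
      show "norm (p + t *\<^sub>R q) \<le> M" using ends[OF u(1)] by (simp add: q_def)
      show "norm (p - t *\<^sub>R q) \<le> M" using ends[of "- u"] u(1) by (simp add: q_def)
    qed
    then show ?thesis by (simp add: p_def add_ac)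
  qed
  then have "norm ((z + norm (a k) *\<^sub>R q) + (\<Sum>n\<in>F. sc (a n) (e n))) \<le> M"
    using insert.prems(1) by (intro insert.IH) auto
  then show ?case using insert.hyps ak by (simp add: add_ac)
qed

lemma suppression_strict_greedy_set:
  assumes "suppression_quasi_greedy sc e K" "1 \<le> K" "finite A"
    and "\<And>n k. n \<in> A \<Longrightarrow> k \<notin> A \<Longrightarrow> norm (coefficient x k) < norm (coefficient x n)"
  shows "norm (x - proj sc e A x) \<le> K * norm x"
proof (cases "A = {}")
  case True
  then show ?thesis using assms(2) mult_right_mono[of 1 K "norm x"] by (simp add: proj_def)
next
  case False
  then have "1 \<le> card A" using assms(3) by (simp add: Suc_le_eq card_gt_0_iff)
  then show ?thesis
    using assms(1) greedy_approx_card_eq_proj[OF assms(3,4)]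
    unfolding suppression_quasi_greedy_def by metis
qed

text \<open>
  On \<open>D\<close> the coefficient of \<open>x\<close> at \<open>n\<close> is scaled by \<open>t / \<bar>x\<^sub>n\<bar> \<le> 1\<close>, which lowers its absolute
  value to \<open>t\<close>: this is the truncation of \<open>x\<close> at height \<open>t\<close>. The level sets of the factors are
  \<open>{n \<in> D. s \<bar>x\<^sub>n\<bar> \<le> t}\<close>, and for \<open>s > 0\<close> keeping only these indices of \<open>D\<close> means
  removing all coefficients of size above \<open>t / s\<close>, which is a greedy suppression.
\<close>

lemma norm_truncation_le:
  assumes sq: "suppression_quasi_greedy sc e K" and K: "1 \<le> K"
    and D: "finite D" and t: "0 < t"
    and large: "\<And>n. n \<in> D \<Longrightarrow> t \<le> norm (coefficient x n)"
    and small: "\<And>n. n \<notin> D \<Longrightarrow> norm (coefficient x n) \<le> t"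
  shows "norm (x - proj sc e D x
    + (\<Sum>n\<in>D. (t / norm (coefficient x n)) *\<^sub>R sc (coefficient x n) (e n))) \<le> K * norm x"
proof (rule norm_weighted_sum_le_level_sets[OF D])
  show "0 \<le> t / norm (coefficient x n) \<and> t / norm (coefficient x n) \<le> 1" if "n \<in> D" for n
    using large[OF that] t by (simp add: divide_le_eq_1)
  fix s :: real
  assume s: "0 \<le> s" "s \<le> 1"
  \<comment> \<open>The condition is multiplied out so that it also covers \<open>s = 0\<close>, where nothing is removed.\<close>
  define \<Lambda> where "\<Lambda> = {n \<in> D. t < s * norm (coefficient x n)}"
  have level: "{n. n \<in> D \<and> s \<le> t / norm (coefficient x n)} = D - \<Lambda>"
  proof -
    have "s \<le> t / norm (coefficient x n) \<longleftrightarrow> \<not> t < s * norm (coefficient x n)" if "n \<in> D" for n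
      using large[OF that] t by (subst pos_le_divide_eq) auto
    then show ?thesis by (auto simp: \<Lambda>_def)
  qed
  have sub: "\<Lambda> \<subseteq> D" by (auto simp: \<Lambda>_def)
  then have "proj sc e D x = proj sc e (D - \<Lambda>) x + proj sc e \<Lambda> x"
    unfolding proj_def using D by (rule sum.subset_diff)
  then have sum_eq: "x - proj sc e D x
      + (\<Sum>n | n \<in> D \<and> s \<le> t / norm (coefficient x n). sc (coefficient x n) (e n))
      = x - proj sc e \<Lambda> x"
    unfolding level by (simp add: proj_def)
  show "norm (x - proj sc e D x
      + (\<Sum>n | n \<in> D \<and> s \<le> t / norm (coefficient x n). sc (coefficient x n) (e n))) \<le> K * norm x"
    unfolding sum_eq
  proof (rule suppression_strict_greedy_set[OF sq K])
    show "finite \<Lambda>" using sub D finite_subset by blast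
    fix n k
    assume n: "n \<in> \<Lambda>" and k: "k \<notin> \<Lambda>"
    have "s * norm (coefficient x k) \<le> t"
    proof (cases "k \<in> D")
      case True
      then show ?thesis using k by (simp add: \<Lambda>_def)
    next
      case False
      have "s * norm (coefficient x k) \<le> 1 * norm (coefficient x k)"
        using s by (intro mult_right_mono) auto
      then show ?thesis using small[OF False] by simp
    qed
    then have "s * norm (coefficient x k) < s * norm (coefficient x n)"
      using n by (simp add: \<Lambda>_def)
    then show "norm (coefficient x k) < norm (coefficient x n)"
      using s by (simp add: mult_less_cancel_left)
  qed
qed

text \<open>
  The factor \<open>C\<close> pays for moving the block from \<open>B - A\<close> to \<open>A - B\<close>, and \<open>K\<close> for the truncation
  of \<open>x - P\<^sub>B x\<close>.
\<close>

lemma norm_suppress_greedy_set_le: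
  assumes sq: "suppression_quasi_greedy sc e K" and K: "1 \<le> K"
    and sym: "symmetric_largest_coeffs sc e C" and C: "1 \<le> C"
    and fin: "finite A" "finite B" and card: "card A = card B"
    and t: "0 < t"
    and large: "\<And>n. n \<in> A \<Longrightarrow> t \<le> norm (coefficient x n)"
    and small: "\<And>n. n \<notin> A \<Longrightarrow> norm (coefficient x n) \<le> t"
  shows "norm (x - proj sc e A x) \<le> C * K * norm (x - proj sc e B x)"
proof -
  define z where "z = x - proj sc e (A \<union> B) x"
  define u where "u = x - proj sc e B x"
  define \<epsilon> where "\<epsilon> n = coefficient x n / of_real (norm (coefficient x n))" for n
  have split: "proj sc e (A \<union> B) x = proj sc e E x + proj sc e (F - E) x"
    if "A \<union> B = E \<union> F" for E F
  proof -
    have fE: "finite E" "finite F" using fin that by (metis finite_Un)+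
    show ?thesis
      unfolding that proj_def using sum.union_disjoint[of E "F - E"] fE by auto
  qed
  have coef_z: "coefficient z n = (if n \<in> A \<union> B then 0 else coefficient x n)" for n
    using fin by (simp add: z_def coef_diff coef_proj)
  have coef_u: "coefficient u n = (if n \<in> B then 0 else coefficient x n)" for n
    using fin by (simp add: u_def coef_diff coef_proj)
  have "proj sc e (A - B) u = proj sc e (A - B) x"
    unfolding proj_def by (rule sum.cong) (auto simp: coef_u)
  then have z_u: "z = u - proj sc e (A - B) u"
    using split[OF Un_commute] by (simp add: z_def u_def)
  have x_A: "x - proj sc e A x = z + (\<Sum>n\<in>B - A. sc (coefficient x n) (e n))"
    using split[of A B] by (simp add: z_def proj_def)
  have "norm (z + (\<Sum>n\<in>B - A. sc (coefficient x n) (e n))) \<le> C * (K * norm u)"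
  proof (rule norm_add_sum_le_unimodular)
    show "norm (coefficient x n) \<le> t" if "n \<in> B - A" for n using small that by simp
    fix \<theta> :: "nat \<Rightarrow> 'k"
    assume \<theta>: "\<And>n. n \<in> B - A \<Longrightarrow> norm (\<theta> n) = 1"
    have "disjoint_greedy_permutation sc e (z + t *\<^sub>R (\<Sum>n\<in>A - B. sc (\<epsilon> n) (e n)))
        (z + t *\<^sub>R (\<Sum>n\<in>B - A. sc (\<theta> n) (e n)))"
      unfolding disjoint_greedy_permutation_def
    proof (intro exI conjI ballI allI)
      show "card (A - B) = card (B - A)"
        using card fin by (simp add: card_Diff_subset_Int Int_commute)
      show "norm (\<epsilon> n) = 1" if "n \<in> A - B" for n
        using large[of n] that t by (auto simp: \<epsilon>_def norm_divide)
      show "norm (coefficient z n) \<le> t" for n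
        using small[of n] t by (auto simp: coef_z)
    qed (use fin \<theta> in \<open>auto simp: supp_def coef_z\<close>)
    then have "norm (z + t *\<^sub>R (\<Sum>n\<in>B - A. sc (\<theta> n) (e n)))
        \<le> C * norm (z + t *\<^sub>R (\<Sum>n\<in>A - B. sc (\<epsilon> n) (e n)))"
      by (rule norm_disjoint_greedy_permutation_le[OF sym])
    also have "z + t *\<^sub>R (\<Sum>n\<in>A - B. sc (\<epsilon> n) (e n)) = u - proj sc e (A - B) u
        + (\<Sum>n\<in>A - B. (t / norm (coefficient u n)) *\<^sub>R sc (coefficient u n) (e n))"
    proof -
      have "t *\<^sub>R sc (\<epsilon> n) (e n) = (t / norm (coefficient u n)) *\<^sub>R sc (coefficient u n) (e n)"
        if "n \<in> A - B" for n
        using that by (simp add: coef_u \<epsilon>_def flip: sc_of_real)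
      then show ?thesis unfolding z_u[symmetric] by (simp add: scaleR_right.sum)
    qed
    also have "norm (u - proj sc e (A - B) u
        + (\<Sum>n\<in>A - B. (t / norm (coefficient u n)) *\<^sub>R sc (coefficient u n) (e n))) \<le> K * norm u"
    proof (rule norm_truncation_le[OF sq K _ t])
      show "finite (A - B)" using fin by simp
      show "t \<le> norm (coefficient u n)" if "n \<in> A - B" for n
        using large that by (simp add: coef_u)
      show "norm (coefficient u n) \<le> t" if "n \<notin> A - B" for n
        using small[of n] that t by (auto simp: coef_u)
    qed
    finally show "norm (z + t *\<^sub>R (\<Sum>n\<in>B - A. sc (\<theta> n) (e n))) \<le> C * (K * norm u)"
      using C by simp
  qed (use fin in simp)
  then show ?thesis by (simp add: x_A u_def mult.assoc)
qed

lemma suppression_symmetric_imp_almost_greedy: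
  assumes sq: "suppression_quasi_greedy sc e K" and K: "1 \<le> K"
    and sym: "symmetric_largest_coeffs sc e C" and C: "1 \<le> C"
  shows "almost_greedy sc e (C * K)"
  unfolding almost_greedy_def
proof (intro allI impI)
  fix x and m :: nat
  assume m: "1 \<le> m"
  have CK: "0 < C * K" using C K by simp
  obtain A where A: "finite A" "card A = m" "greedy_approx sc e m x = proj sc e A x"
    "\<And>n k. n \<in> A \<Longrightarrow> k \<notin> A \<Longrightarrow> norm (coefficient x k) \<le> norm (coefficient x n)"
    using greedy_approx_eq_proj[of m x] by blast
  have "A \<noteq> {}" using A m by auto
  define t where "t = Min ((\<lambda>n. norm (coefficient x n)) ` A)"
  have large: "t \<le> norm (coefficient x n)" if "n \<in> A" for n
    unfolding t_def using A(1) that by simp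
  have small: "norm (coefficient x n) \<le> t" if "n \<notin> A" for n
    unfolding t_def using A(1,4) \<open>A \<noteq> {}\<close> that by simp
  have "norm (x - proj sc e A x) \<le> C * K * norm (x - proj sc e B x)"
    if B: "finite B" "card B = m" for B
  proof (cases "0 < t")
    case True
    then show ?thesis
      using norm_suppress_greedy_set_le[OF sq K sym C A(1) B(1)] A(2) B(2) large small by simp
  next
    \<comment> \<open>With \<open>t = 0\<close> the set \<open>A\<close> contains the whole support, so the greedy remainder vanishes.\<close>
    case False
    then have "coefficient x n = 0" if "n \<notin> A" for n
      using small[OF that] norm_le_zero_iff order_trans not_less by metis
    then have "(\<lambda>n. sc (coefficient x n) (e n)) sums proj sc e A x"
      unfolding proj_def using A(1) by (intro sums_finite) auto
    then have "x = proj sc e A x" using coef_sums sums_unique2 by blast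
    then show ?thesis using CK by simp
  qed
  then have "norm (x - proj sc e A x) / (C * K)
      \<le> (INF B\<in>{B. finite B \<and> card B = m}. norm (x - proj sc e B x))"
    using CK A(1,2) by (intro cINF_greatest) (auto simp: pos_divide_le_eq mult.commute)
  then show "norm (x - greedy_approx sc e m x)
      \<le> C * K * (INF B\<in>{B. finite B \<and> card B = m}. norm (x - proj sc e B x))"
    using CK unfolding A(3) by (simp add: pos_divide_le_eq mult.commute)
qed

end

theorem proposition2p1:
  fixes sc :: "'k::real_normed_field \<Rightarrow> 'a::banach \<Rightarrow> 'a"
    and e :: "nat \<Rightarrow> 'a"
  assumes "banach_space_over sc"
    and "infinite_dimensional sc"
    and "separable_type TYPE('a)"
    and "schauder_basis sc e"
    and "semi_normalized e"
  shows "(\<forall>C\<ge>1. almost_greedy sc e C \<longrightarrow>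
            suppression_quasi_greedy sc e C \<and> symmetric_largest_coeffs sc e C) \<and>
         (\<forall>C\<ge>1. \<forall>K\<ge>1. suppression_quasi_greedy sc e K \<and> symmetric_largest_coeffs sc e C \<longrightarrow>
            almost_greedy sc e (C * K))"
proof -
  interpret semi_normalized_basis sc e
    using assms(1,4,5) by (simp add: semi_normalized_basis_def semi_normalized_basis_axioms_def)
  show ?thesis
  proof (intro conjI allI impI)
    fix C :: real
    assume "1 \<le> C" and ag: "almost_greedy sc e C"
    then show "suppression_quasi_greedy sc e C"
      by (intro almost_greedy_imp_suppression_quasi_greedy) auto
    show "symmetric_largest_coeffs sc e C"
      unfolding symmetric_largest_coeffs_def
      using almost_greedy_imp_symmetric[OF ag \<open>1 \<le> C\<close>] by blast
  next
    fix C K :: real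
    assume "1 \<le> C" "1 \<le> K" "suppression_quasi_greedy sc e K \<and> symmetric_largest_coeffs sc e C"
    then show "almost_greedy sc e (C * K)" by (intro suppression_symmetric_imp_almost_greedy) auto
  qed
qed

end
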